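(* Assume $\|\partial_0 f\|<1$, and let $R$, $D_a(0)$ and $N_p^c$ be as defined in the context. Let $p\geq 0$ be an integer. For any $c\in(0,(p+1)R^2]$, the set $N_p^c$ is included in the domain of attraction $D_a(0)$.
   Context: Let $\Omega\subset\mathbb{R}^n$ be a domain (open connected set) with $0\in\Omega$, and let $f:\Omega\to\Omega$ be an $\mathbb{R}$-analytic function with $f(0)=0$. Write $f^k$ for the $k$-th iterate of $f$ ($f^0=\mathrm{id}$), $\|\cdot\|$ for the Euclidean norm on $\mathbb{R}^n$ and for the induced operator norm on matrices, $\partial_0 f$ for the Jacobian matrix of $f$ at $0$, and $B(r)=\{x\in\mathbb{R}^n:\|x\|<r\}$ for $r>0$. The domain of attraction of $0$ is $D_a(0)=\{x\in\Omega: f^k(x)\to 0 \text{ as } k\to\infty\}$. Standing assumption: $\|\partial_0 f\|<1$; under this assumption there is $r>0$ with $B(r)\subset\Omega$ and $\|f(x)\|<\|x\|$ for all $x\in B(r)\setminus\{0\}$. Let $R>0$ be the largest number such that $B(R)\subset\Omega$ and $\|f(x)\|<\|x\|$ for any $x\in B(R)\setminus\{0\}$; if every $r>0$ has this property, then $R=+\infty$ and $B(R)=\Omega=\mathbb{R}^n$. For an integer $p\ge 0$ and $x\in\Omega$ put $V_p(x)=\sum_{k=0}^{p}\|f^k(x)\|^2$. For $p\geq 0$ and $c>0$ put $N_p^c=\{x\in\Omega: V_p(x)<c\}$, with $N_p^c=\Omega$ if $c=+\infty$. *)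

theory Defs
  imports "HOL-Analysis.Analysis"
begin

(* Real-analyticity in several variables: near each point of S, f is the sum of a convergent
   power series in the coordinates.  As 'n is finite, the multi-indices are all functions
   'n => nat.  has_sum is unconditional (in finite dimension: absolute) convergence.
   The notion is meant for open S; f is then not constrained outside S, since the radius
   may be taken so small that the ball lies in S. *)
definition real_analytic_on :: "(real^'n \<Rightarrow> real^'m) \<Rightarrow> (real^'n) set \<Rightarrow> bool"
    (infixl "(real'_analytic'_on)" 50) where
  "f real_analytic_on S \<longleftrightarrow>
     (\<forall>a\<in>S. \<exists>r>0. \<exists>coef :: ('n \<Rightarrow> nat) \<Rightarrow> real^'m. \<forall>x\<in>ball a r.
        ((\<lambda>\<alpha>. (\<Prod>i\<in>UNIV. (x $ i - a $ i) ^ \<alpha> i) *\<^sub>R coef \<alpha>) has_sum f x) UNIV)"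

definition domain_of_attraction :: "(real^'n \<Rightarrow> real^'n) \<Rightarrow> (real^'n) set \<Rightarrow> (real^'n) set" where
  "domain_of_attraction f \<Omega> = {x\<in>\<Omega>. (\<lambda>k. (f ^^ k) x) \<longlonglongrightarrow> 0}"

(* Ball about 0 with extended radius; eball0 \<infinity> is the whole space. *)
definition eball0 :: "ereal \<Rightarrow> (real^'n) set" where
  "eball0 r = {x. ereal (norm x) < r}"

(* The largest radius R (possibly \<infinity>) on whose ball f strictly decreases the norm. *)
definition attraction_radius :: "(real^'n \<Rightarrow> real^'n) \<Rightarrow> (real^'n) set \<Rightarrow> ereal" where
  "attraction_radius f \<Omega> =
     (GREATEST R. 0 < R \<and> eball0 R \<subseteq> \<Omega> \<and> (\<forall>x\<in>eball0 R - {0}. norm (f x) < norm x))"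

definition V :: "(real^'n \<Rightarrow> real^'n) \<Rightarrow> nat \<Rightarrow> real^'n \<Rightarrow> real" where
  "V f p x = (\<Sum>k=0..p. (norm ((f ^^ k) x))\<^sup>2)"

(* For c = \<infinity> this is all of \<Omega>. *)
definition N :: "(real^'n \<Rightarrow> real^'n) \<Rightarrow> (real^'n) set \<Rightarrow> nat \<Rightarrow> ereal \<Rightarrow> (real^'n) set" where
  "N f \<Omega> p c = {x\<in>\<Omega>. ereal (V f p x) < c}"

end

theory Submission
  imports Defs
begin

text \<open>
  The bound \<open>V f p x < (p + 1) * R\<^sup>2\<close> says that the \<open>p + 1\<close> points \<open>x, f x, \<dots>, (f ^^ p) x\<close> have mean
  square norm below \<open>R\<^sup>2\<close>, so at least one of them lies in the ball of radius \<open>R\<close>. From there on the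
  orbit stays in a compact ball on which \<open>f\<close> is continuous and strictly decreases the norm away
  from the origin. The norms along the orbit therefore decrease to some limit; by compactness an
  accumulation point \<open>z\<close> has \<open>norm (f z) = norm z\<close>, which forces \<open>z = 0\<close>
  (lemma \<open>iterates_tendsto_0\<close>).

  This uses \<open>R\<close> only through the properties of its ball. As \<open>R\<close> is given by \<open>GREATEST\<close>, these
  require that a greatest radius exists (lemma \<open>attraction_radius_greatest\<close>): the admissible radii
  are closed under suprema, because the ball of the supremum is the union of the balls, and at least
  one radius is admissible, because \<open>f\<close> is differentiable at \<open>0\<close> with derivative of norm below \<open>1\<close>.
  Analyticity enters through differentiability alone. At the centre of an expansion it follows from
  the quadratic bound on the terms of degree at least two
  (lemma \<open>power_series_differentiable_at_centre\<close>); since every point of the domain is the centre of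
  an expansion, no re-expansion about other points is involved.
\<close>

section \<open>Differentiability of real analytic maps\<close>

text \<open>
  In finite dimension unconditional convergence is absolute: each coordinate is an unconditionally
  summable real family, and the norm is at most the sum of the absolute coordinates.
\<close>

lemma summable_on_imp_norm_summable_on:
  fixes g :: "'a \<Rightarrow> 'b::euclidean_space"
  assumes "g summable_on A"
  shows "(\<lambda>x. norm (g x)) summable_on A"
proof (rule Infinite_Sum.abs_summable_on_comparison_test')
  have "(\<lambda>x. \<bar>g x \<bullet> b\<bar>) summable_on A" for b
  proof -
    have "(\<lambda>x. g x \<bullet> b) summable_on A"
      using summable_on_bounded_linear[OF bounded_linear_inner_left assms] .
    then show ?thesis
      using summable_on_iff_abs_summable_on_real[of "\<lambda>x. g x \<bullet> b" A] by simp
  qed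
  moreover have "(\<lambda>x. \<Sum>b\<in>S. \<bar>g x \<bullet> b\<bar>) summable_on A"
    if "finite S" "\<And>b. (\<lambda>x. \<bar>g x \<bullet> b\<bar>) summable_on A" for S
    using that by (induction S rule: finite_induct) (auto intro: summable_on_add)
  ultimately show "(\<lambda>x. \<Sum>b\<in>Basis. \<bar>g x \<bullet> b\<bar>) summable_on A"
    by simp
  show "norm (g x) \<le> (\<Sum>b\<in>Basis. \<bar>g x \<bullet> b\<bar>)" for x
    by (rule norm_le_l1)
qed

definition monomial :: "real^'n \<Rightarrow> ('n \<Rightarrow> nat) \<Rightarrow> real" where
  "monomial y \<alpha> = (\<Prod>i\<in>UNIV. (y $ i) ^ \<alpha> i)"

definition total_degree :: "('n::finite \<Rightarrow> nat) \<Rightarrow> nat" where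
  "total_degree \<alpha> = (\<Sum>i\<in>UNIV. \<alpha> i)"

definition unit_index :: "'n \<Rightarrow> 'n \<Rightarrow> nat" where
  "unit_index i = (\<lambda>j. if j = i then 1 else 0)"

lemma abs_monomial_le: "\<bar>monomial y \<alpha>\<bar> \<le> norm y ^ total_degree \<alpha>"
  unfolding monomial_def total_degree_def power_sum abs_prod
  by (intro prod_mono) (auto simp: power_abs intro!: power_mono component_le_norm_cart)

lemma monomial_const: "monomial (\<chi> i. s) \<alpha> = s ^ total_degree \<alpha>"
  by (simp add: monomial_def total_degree_def power_sum)

lemma monomial_zero_index: "monomial y (\<lambda>_. 0) = 1"
  by (simp add: monomial_def)

lemma monomial_unit_index: "monomial y (unit_index i) = y $ i"
proof -
  have "monomial y (unit_index i) = (\<Prod>j\<in>UNIV. if j = i then y $ j else 1)"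
    unfolding monomial_def unit_index_def by (intro prod.cong) auto
  then show ?thesis by simp
qed

lemma inj_unit_index: "inj unit_index"
proof (rule injI)
  fix i j :: 'a assume "unit_index i = unit_index j"
  from fun_cong[OF this, of i] show "i = j" by (simp add: unit_index_def split: if_splits)
qed

lemma zero_notin_range_unit_index: "(\<lambda>_. 0) \<notin> range unit_index"
proof
  assume "(\<lambda>_ :: 'a. 0) \<in> range unit_index"
  then obtain i :: 'a where "(\<lambda>_. 0) = unit_index i" by (rule rangeE)
  from fun_cong[OF this, of i] show False by (simp add: unit_index_def)
qed

lemma total_degree_le_1_cases:
  assumes "total_degree \<alpha> < 2"
  shows "\<alpha> \<in> insert (\<lambda>_. 0) (range unit_index)"
proof (cases "\<exists>i. \<alpha> i \<noteq> 0")
  case True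
  then obtain i where i: "\<alpha> i \<noteq> 0" by blast
  have split: "total_degree \<alpha> = \<alpha> i + (\<Sum>j\<in>UNIV - {i}. \<alpha> j)"
    unfolding total_degree_def by (rule sum.remove) auto
  with assms i have one: "\<alpha> i = 1" and "(\<Sum>j\<in>UNIV - {i}. \<alpha> j) = 0" by linarith+
  then have "\<alpha> j = 0" if "j \<noteq> i" for j
    using that by auto
  with one have "\<alpha> = unit_index i"
    by (auto simp: unit_index_def)
  then show ?thesis by blast
qed auto

text \<open>
  Convergence at the one point with all coordinates equal to \<open>s\<close> makes \<open>s ^ |\<alpha>| * norm (coef \<alpha>)\<close>
  summable. The terms of degree at least two at \<open>y\<close> are dominated by \<open>(norm y / s)\<^sup>2\<close> times this
  family, so that what remains after the constant and the linear terms is quadratically small.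
\<close>

lemma power_series_quadratic_remainder:
  fixes coef :: "('n::finite \<Rightarrow> nat) \<Rightarrow> 'b::euclidean_space"
  assumes r: "r > 0"
    and sums: "\<And>y. norm y < r \<Longrightarrow> ((\<lambda>\<alpha>. monomial y \<alpha> *\<^sub>R coef \<alpha>) has_sum g y) UNIV"
  obtains s K where "s > 0"
    "\<And>y. norm y \<le> s \<Longrightarrow>
       norm (g y - coef (\<lambda>_. 0) - (\<Sum>i\<in>UNIV. (y $ i) *\<^sub>R coef (unit_index i))) \<le> K * (norm y)\<^sup>2"
proof -
  define n where "n = real CARD('n)"
  have n: "n \<ge> 1" unfolding n_def by (simp add: Suc_leI)
  \<comment> \<open>The point with all coordinates \<open>s\<close> has norm at most \<open>n * s\<close>, which must stay below \<open>r\<close>.\<close>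
  define s where "s = r / (n + 1)"
  have s: "s > 0" "n * s < r" using r n by (auto simp: s_def field_simps)
  have "s \<le> n * s" using n s by simp
  with s have "s < r" by linarith
  define A :: "('n \<Rightarrow> nat) set" where "A = insert (\<lambda>_. 0) (range unit_index)"
  define G where "G = (\<lambda>\<alpha>. s ^ total_degree \<alpha> * norm (coef \<alpha>))"
  have "norm (\<chi> i::'n. s) \<le> (\<Sum>i\<in>(UNIV::'n set). \<bar>s\<bar>)"
    using norm_le_l1_cart[of "\<chi> i::'n. s"] by simp
  then have "norm (\<chi> i::'n. s) < r"
    using s by (simp add: n_def)
  from sums[OF this] have "(\<lambda>\<alpha>. s ^ total_degree \<alpha> *\<^sub>R coef \<alpha>) summable_on UNIV"
    unfolding monomial_const by (auto simp: summable_on_def)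
  from summable_on_imp_norm_summable_on[OF this] have "G summable_on UNIV"
    using s by (simp add: G_def)
  then have G: "G summable_on (UNIV - A)"
    by (rule summable_on_subset_banach) auto
  define M where "M = infsum G (UNIV - A)"
  have "norm (g y - coef (\<lambda>_. 0) - (\<Sum>i\<in>UNIV. (y $ i) *\<^sub>R coef (unit_index i)))
      \<le> M / s\<^sup>2 * (norm y)\<^sup>2" if y: "norm y \<le> s" for y
  proof -
    let ?t = "\<lambda>\<alpha>. monomial y \<alpha> *\<^sub>R coef \<alpha>"
    define H where "H = (\<lambda>\<alpha>. (norm y / s)\<^sup>2 * G \<alpha>)"
    have "sum ?t A = coef (\<lambda>_. 0) + (\<Sum>i\<in>UNIV. (y $ i) *\<^sub>R coef (unit_index i))"
      unfolding A_def
      by (subst sum.insert)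
        (auto simp: zero_notin_range_unit_index monomial_zero_index sum.reindex[OF inj_unit_index]
          monomial_unit_index)
    moreover have "(?t has_sum (g y - sum ?t A)) (UNIV - A)"
      by (rule has_sum_Diff) (use sums y \<open>s < r\<close> in \<open>auto simp: A_def\<close>)
    ultimately have tail: "(?t has_sum
        (g y - coef (\<lambda>_. 0) - (\<Sum>i\<in>UNIV. (y $ i) *\<^sub>R coef (unit_index i)))) (UNIV - A)"
      by (simp add: algebra_simps)
    have H: "(H has_sum ((norm y / s)\<^sup>2 * M)) (UNIV - A)"
      unfolding H_def M_def by (intro has_sum_cmult_right has_sum_infsum G)
    have le: "norm (?t \<alpha>) \<le> H \<alpha>" if "\<alpha> \<in> UNIV - A" for \<alpha>
    proof -
      have "2 \<le> total_degree \<alpha>"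
        using that total_degree_le_1_cases[of \<alpha>] by (force simp: A_def)
      then have "(norm y / s) ^ total_degree \<alpha> \<le> (norm y / s)\<^sup>2"
        using y s by (intro power_decreasing) auto
      then have "norm y ^ total_degree \<alpha> \<le> (norm y / s)\<^sup>2 * s ^ total_degree \<alpha>"
        using s by (simp add: power_divide[of _ _ "total_degree \<alpha>"] pos_divide_le_eq)
      with abs_monomial_le[of y \<alpha>]
      have "\<bar>monomial y \<alpha>\<bar> \<le> (norm y / s)\<^sup>2 * s ^ total_degree \<alpha>" by linarith
      then show ?thesis
        unfolding H_def G_def norm_scaleR mult.assoc[symmetric]
        by (intro mult_right_mono) auto
    qed
    have "(\<lambda>\<alpha>. norm (?t \<alpha>)) summable_on (UNIV - A)"
      using has_sum_imp_summable[OF H] le by (rule Infinite_Sum.abs_summable_on_comparison_test')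
    then have sn: "((\<lambda>\<alpha>. norm (?t \<alpha>)) has_sum infsum (\<lambda>\<alpha>. norm (?t \<alpha>)) (UNIV - A)) (UNIV - A)"
      by (rule has_sum_infsum)
    from norm_has_sum_bound[OF sn tail] has_sum_mono[OF sn H le] show ?thesis
      by (simp add: power_divide mult.commute)
  qed
  with s that show ?thesis by blast
qed

lemma power_series_differentiable_at_centre:
  fixes coef :: "('n::finite \<Rightarrow> nat) \<Rightarrow> 'b::euclidean_space"
  assumes r: "r > 0"
    and sums: "\<And>y. norm y < r \<Longrightarrow> ((\<lambda>\<alpha>. monomial y \<alpha> *\<^sub>R coef \<alpha>) has_sum f (a + y)) UNIV"
  shows "f differentiable (at a)"
proof -
  define D where "D y = (\<Sum>i\<in>UNIV. (y $ i) *\<^sub>R coef (unit_index i))" for y :: "real^'n"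
  obtain s K where s: "s > 0"
    and rem: "\<And>y. norm y \<le> s \<Longrightarrow> norm (f (a + y) - coef (\<lambda>_. 0) - D y) \<le> K * (norm y)\<^sup>2"
    using power_series_quadratic_remainder[of r coef "\<lambda>y. f (a + y)"] r sums unfolding D_def by blast
  from rem[of 0] s have f0: "f a = coef (\<lambda>_. 0)" by (simp add: D_def)
  have "bounded_linear D"
    unfolding D_def
    by (intro bounded_linear_sum bounded_linear_scaleR_const) (simp add: bounded_linear_vec_nth)
  moreover have "(\<lambda>h. norm (f (a + h) - f a - D h) / norm h) \<midarrow>0\<rightarrow> 0"
  proof (rule Lim_null_comparison)
    have "\<forall>\<^sub>F h in at 0. norm h < s \<and> h \<noteq> (0 :: real^'n)"
      unfolding eventually_at using s by (intro exI[of _ s]) auto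
    then show "\<forall>\<^sub>F h in at 0. norm (norm (f (a + h) - f a - D h) / norm h) \<le> K * norm h"
    proof eventually_elim
      case (elim h)
      with rem[of h] f0 show ?case
        by (simp add: pos_divide_le_eq power2_eq_square mult.assoc)
    qed
    show "(\<lambda>h :: real^'n. K * norm h) \<midarrow>0\<rightarrow> 0"
      by (auto intro!: tendsto_eq_intros)
  qed
  ultimately have "(f has_derivative D) (at a)"
    by (simp add: has_derivative_at)
  then show ?thesis by (auto simp: differentiable_def)
qed

lemma real_analytic_imp_differentiable:
  assumes "f real_analytic_on S" and "a \<in> S"
  shows "f differentiable (at a)"
proof -
  from assms obtain r coef where r: "r > 0" and sums: "\<forall>x\<in>ball a r.
        ((\<lambda>\<alpha>. (\<Prod>i\<in>UNIV. (x $ i - a $ i) ^ \<alpha> i) *\<^sub>R coef \<alpha>) has_sum f x) UNIV"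
    unfolding real_analytic_on_def by blast
  show ?thesis
  proof (rule power_series_differentiable_at_centre[OF r])
    fix y :: "real^'a" assume "norm y < r"
    then have "a + y \<in> ball a r" by (simp add: dist_norm)
    with sums show "((\<lambda>\<alpha>. monomial y \<alpha> *\<^sub>R coef \<alpha>) has_sum f (a + y)) UNIV"
      unfolding monomial_def by force
  qed
qed

section \<open>The radius of attraction\<close>

lemma norm_decreasing_near_0:
  fixes f :: "'a::real_normed_vector \<Rightarrow> 'b::real_normed_vector"
  assumes D: "(f has_derivative D) (at 0)" and "onorm D < 1" and "f 0 = 0"
  obtains d where "d > 0" "\<And>x. norm x < d \<Longrightarrow> x \<noteq> 0 \<Longrightarrow> norm (f x) < norm x"
proof -
  \<comment> \<open>Half of the gap \<open>1 - onorm D\<close> absorbs the error of the linear approximation.\<close>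
  define e where "e = (1 - onorm D) / 2"
  have e: "e > 0" "onorm D + e < 1" using assms(2) by (auto simp: e_def field_simps)
  with D obtain d where d: "d > 0"
    "\<And>y. norm y < d \<Longrightarrow> norm (f y - D y) \<le> e * norm y"
    unfolding has_derivative_at_alt \<open>f 0 = 0\<close> by (metis diff_zero)
  have "norm (f x) < norm x" if x: "norm x < d" "x \<noteq> 0" for x
  proof -
    have "norm (f x) \<le> norm (D x) + norm (f x - D x)"
      by (metis add.commute diff_add_cancel norm_triangle_ineq)
    also have "\<dots> \<le> onorm D * norm x + e * norm x"
      using d(2)[OF x(1)] onorm[OF has_derivative_bounded_linear[OF D], of x] by simp
    also have "\<dots> = (onorm D + e) * norm x" by (simp add: algebra_simps)
    also have "\<dots> < norm x" using e x by simp
    finally show ?thesis .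
  qed
  with d that show ?thesis by blast
qed

lemma attraction_radius_greatest:
  fixes f :: "real^'n \<Rightarrow> real^'n"
  assumes "open \<Omega>" "0 \<in> \<Omega>" "f 0 = 0" and D: "(f has_derivative D) (at 0)" and "onorm D < 1"
  shows "0 < attraction_radius f \<Omega>" "eball0 (attraction_radius f \<Omega>) \<subseteq> \<Omega>"
    "\<And>x. x \<in> eball0 (attraction_radius f \<Omega>) \<Longrightarrow> x \<noteq> 0 \<Longrightarrow> norm (f x) < norm x"
proof -
  define P where "P R \<longleftrightarrow> 0 < R \<and> eball0 R \<subseteq> \<Omega> \<and> (\<forall>x\<in>eball0 R - {0}. norm (f x) < norm x)" for R
  obtain d where d: "d > 0" "\<And>x. norm x < d \<Longrightarrow> x \<noteq> 0 \<Longrightarrow> norm (f x) < norm x"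
    using norm_decreasing_near_0[OF D \<open>onorm D < 1\<close> \<open>f 0 = 0\<close>] by blast
  obtain e where e: "e > 0" "ball 0 e \<subseteq> \<Omega>"
    using assms(1,2) open_contains_ball by blast
  have P_local: "P (ereal (min d e))"
    unfolding P_def eball0_def using d e by (auto simp: subset_iff)
  define R where "R = Sup {R. P R}"
  have "ereal (min d e) \<le> R"
    unfolding R_def by (rule Sup_upper) (use P_local in blast)
  with P_local have "0 < R"
    unfolding P_def by (meson less_le_trans)
  moreover have "\<exists>r. P r \<and> x \<in> eball0 r" if "x \<in> eball0 R" for x
    using that by (auto simp: eball0_def R_def less_Sup_iff)
  ultimately have "P R" unfolding P_def by blast
  then have "attraction_radius f \<Omega> = R"
    unfolding attraction_radius_def P_def[symmetric]
    by (rule Greatest_equality) (auto simp: R_def Sup_upper)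
  with \<open>P R\<close> show "0 < attraction_radius f \<Omega>" "eball0 (attraction_radius f \<Omega>) \<subseteq> \<Omega>"
    "\<And>x. x \<in> eball0 (attraction_radius f \<Omega>) \<Longrightarrow> x \<noteq> 0 \<Longrightarrow> norm (f x) < norm x"
    by (auto simp: P_def)
qed

section \<open>Convergence of the iterates\<close>

text \<open>
  The pointwise strict inequality gives no contraction factor that is uniform up to the origin;
  compactness replaces it. Along a convergent subsequence of the orbit, with limit \<open>z\<close>, both the
  points and their images under \<open>f\<close> have norms tending to the limit of the monotone sequence of
  norms, so \<open>norm (f z) = norm z\<close>.
\<close>

lemma iterates_tendsto_0:
  fixes f :: "'a::euclidean_space \<Rightarrow> 'a"
  assumes cont: "continuous_on (cball 0 (norm y)) f" and "f 0 = 0"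
    and dec: "\<And>z. norm z \<le> norm y \<Longrightarrow> z \<noteq> 0 \<Longrightarrow> norm (f z) < norm z"
  shows "(\<lambda>k. (f ^^ k) y) \<longlonglongrightarrow> 0"
proof -
  define u where "u k = (f ^^ k) y" for k
  have u_Suc: "u (Suc k) = f (u k)" for k by (simp add: u_def)
  have le: "norm (f z) \<le> norm z" if "norm z \<le> norm y" for z
    using dec[OF that] \<open>f 0 = 0\<close> by (cases "z = 0") auto
  have bound: "norm (u k) \<le> norm y" for k
  proof (induction k)
    case (Suc k)
    then show ?case using le[of "u k"] by (simp add: u_Suc)
  qed (simp add: u_def)
  have "decseq (\<lambda>k. norm (u k))"
    using le bound by (intro decseq_SucI) (simp add: u_Suc)
  then obtain L where L: "(\<lambda>k. norm (u k)) \<longlonglongrightarrow> L"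
    using decseq_convergent[of "\<lambda>k. norm (u k)" 0] by auto
  obtain z \<sigma> where z: "z \<in> cball 0 (norm y)" and \<sigma>: "strict_mono \<sigma>" and lim: "(u \<circ> \<sigma>) \<longlonglongrightarrow> z"
    using compact_cball[of 0 "norm y"] bound unfolding compact_def
    by (metis dist_0_norm mem_cball)
  have "(\<lambda>n. norm (u (\<sigma> n))) \<longlonglongrightarrow> L"
    using LIMSEQ_subseq_LIMSEQ[OF L \<sigma>] by (simp add: o_def)
  moreover have "(\<lambda>n. norm (u (\<sigma> n))) \<longlonglongrightarrow> norm z"
    using tendsto_norm[OF lim] by (simp add: o_def)
  ultimately have "norm z = L" using LIMSEQ_unique by blast
  have "strict_mono (\<lambda>n. Suc (\<sigma> n))"
    using \<sigma> by (simp add: strict_mono_def)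
  then have "(\<lambda>n. norm (u (Suc (\<sigma> n)))) \<longlonglongrightarrow> L"
    using LIMSEQ_subseq_LIMSEQ[OF L] by (fastforce simp: o_def)
  moreover have "(f \<circ> (u \<circ> \<sigma>)) \<longlonglongrightarrow> f z"
    using cont lim z bound unfolding continuous_on_sequentially by auto
  then have "(\<lambda>n. norm (u (Suc (\<sigma> n)))) \<longlonglongrightarrow> norm (f z)"
    using tendsto_norm by (force simp: o_def u_Suc)
  ultimately have "norm (f z) = norm z"
    using LIMSEQ_unique \<open>norm z = L\<close> by blast
  with dec[of z] z have "z = 0" by auto
  with \<open>norm z = L\<close> L have "u \<longlonglongrightarrow> 0"
    by (simp add: tendsto_norm_zero_iff)
  then show ?thesis unfolding u_def .
qed

text \<open>
  A pigeonhole on the mean of the \<open>p + 1\<close> squares. The sign of \<open>R\<close> has to be given, as \<open>R\<^sup>2\<close> loses it.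
\<close>

lemma V_less_imp_iterate_in_eball0:
  assumes V: "ereal (V f p x) < ereal (real (p + 1)) * R\<^sup>2" and "0 < R"
  shows "\<exists>k\<le>p. (f ^^ k) x \<in> eball0 R"
proof (cases R)
  case (real r)
  show ?thesis
  proof (rule ccontr)
    assume "\<not> ?thesis"
    then have ge: "r \<le> norm ((f ^^ k) x)" if "k \<le> p" for k
      using that by (auto simp: eball0_def real not_less)
    have "(\<Sum>k=0..p. r\<^sup>2) \<le> V f p x"
      unfolding V_def using ge \<open>0 < R\<close> real by (intro sum_mono power_mono) auto
    with V show False by (simp add: real)
  qed
qed (use \<open>0 < R\<close> in \<open>auto simp: eball0_def\<close>)

theorem theorem2p5:
  fixes f :: "real^'n \<Rightarrow> real^'n" and \<Omega> :: "(real^'n) set" and p :: nat and c :: ereal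
  assumes "open \<Omega>" and "connected \<Omega>" and "0 \<in> \<Omega>"
    and "f ` \<Omega> \<subseteq> \<Omega>" and "f real_analytic_on \<Omega>" and "f 0 = 0"
    and "onorm ((*v) (jacobian f (at 0))) < 1"
    and "c \<in> {0 <.. ereal (real (p + 1)) * (attraction_radius f \<Omega>)\<^sup>2}"
  shows "N f \<Omega> p c \<subseteq> domain_of_attraction f \<Omega>"
proof
  fix x assume "x \<in> N f \<Omega> p c"
  then have "x \<in> \<Omega>" and "ereal (V f p x) < c" by (auto simp: N_def)
  define R where "R = attraction_radius f \<Omega>"
  have diff: "f differentiable (at a)" if "a \<in> \<Omega>" for a
    using real_analytic_imp_differentiable[OF assms(5) that] .
  have "(f has_derivative ((*v) (jacobian f (at 0)))) (at 0)"
    using diff[OF \<open>0 \<in> \<Omega>\<close>] jacobian_works by blast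
  note R = attraction_radius_greatest[OF assms(1,3,6) this assms(7), folded R_def]
  have "ereal (V f p x) < ereal (real (p + 1)) * R\<^sup>2"
    using \<open>ereal (V f p x) < c\<close> assms(8) unfolding R_def by auto
  then obtain k where k: "(f ^^ k) x \<in> eball0 R"
    using V_less_imp_iterate_in_eball0 R(1) by blast
  define y where "y = (f ^^ k) x"
  have in_ball: "z \<in> eball0 R" if "norm z \<le> norm y" for z
    using that k unfolding eball0_def y_def
    by (metis (mono_tags, lifting) ereal_less_eq(3) le_less_trans mem_Collect_eq)
  have "(\<lambda>m. (f ^^ m) y) \<longlonglongrightarrow> 0"
  proof (rule iterates_tendsto_0)
    show "continuous_on (cball 0 (norm y)) f"
      using in_ball R(2) diff
      by (intro continuous_at_imp_continuous_on ballI differentiable_imp_continuous_within) auto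
  qed (use in_ball R(3) \<open>f 0 = 0\<close> in auto)
  then have "(\<lambda>m. (f ^^ (m + k)) x) \<longlonglongrightarrow> 0"
    by (simp add: y_def funpow_add)
  then have "(\<lambda>m. (f ^^ m) x) \<longlonglongrightarrow> 0"
    by (rule LIMSEQ_offset)
  with \<open>x \<in> \<Omega>\<close> show "x \<in> domain_of_attraction f \<Omega>"
    by (simp add: domain_of_attraction_def)
qed

end
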